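(* For every integer $n\ge 5$ there are $a_0,\ldots,a_{n-1}\in\mathbb{C}$ such that no root of the equation $x^n+a_{n-1}x^{n-1}+\ldots+a_1x+a_0=0$ is expressible by radicals from $\{1,a_0,\ldots,a_{n-1}\}$.
   Context: Let $X\subset\mathbb{C}$ be a subset containing the number $1$. A complex number $a$ is called expressible by radicals from $X$ if some set containing $a$ can be obtained from $X$ by finitely many of the following operations: to a given set $M\subset\mathbb{C}$ containing numbers $x,y\in M$ one can add any of the numbers $x+y$, $x-y$, $xy$; the number $x/y$ when $y\ne 0$; and any number $r\in\mathbb{C}$ such that $r^m=x$ for some integer $m>0$. *)

theory Defs
  imports Complex_Main
begin

inductive radical_step :: "complex set \<Rightarrow> complex set \<Rightarrow> bool" where
  add: "x \<in> M \<Longrightarrow> y \<in> M \<Longrightarrow> radical_step M (insert (x + y) M)"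
| diff: "x \<in> M \<Longrightarrow> y \<in> M \<Longrightarrow> radical_step M (insert (x - y) M)"
| mult: "x \<in> M \<Longrightarrow> y \<in> M \<Longrightarrow> radical_step M (insert (x * y) M)"
| divide: "x \<in> M \<Longrightarrow> y \<in> M \<Longrightarrow> y \<noteq> 0 \<Longrightarrow> radical_step M (insert (x / y) M)"
| root: "x \<in> M \<Longrightarrow> m > 0 \<Longrightarrow> r ^ m = x \<Longrightarrow> radical_step M (insert r M)"

(* The notion is intended for sets X containing 1; this is not built into the
   definition and has to be ensured where it is used. *)
definition expressible_by_radicals :: "complex set \<Rightarrow> complex \<Rightarrow> bool" where
  "expressible_by_radicals X a \<longleftrightarrow> (\<exists>M. radical_step\<^sup>*\<^sup>* X M \<and> a \<in> M)"

end

theory Submission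
  imports Defs "HOL-Computational_Algebra.Fundamental_Theorem_Algebra"
    "HOL-Analysis.Continuum_Not_Denumerable"
begin

text \<open>Take for the roots \<open>x 0, \<dots>, x (n - 1)\<close> algebraically independent numbers and for the
  \<open>a i\<close> the coefficients of the polynomial with these roots. Every permutation of the roots
  extends to an isomorphism between subfields of the complex numbers that fixes all \<open>a i\<close> and all
  roots of unity, and by Zorn's lemma the subfields can be chosen closed under all radicals.
  The invariant preserved by adjoining numbers to a set \<open>M\<close> is: every 3-cycle of the roots is
  induced by such an isomorphism that fixes \<open>M\<close> pointwise. The field operations clearly preserve
  it. For a radical \<open>r\<close> of a number in \<open>M\<close>, write the 3-cycle as a commutator of two 3-cycles,
  which is possible because \<open>n \<ge> 5\<close>; the commutator of the corresponding isomorphisms fixes \<open>r\<close>,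
  since each of them multiplies \<open>r\<close> by a root of unity. A set with this property contains no
  root, as some 3-cycle moves it.

  A partial isomorphism is represented by its graph, so that partial isomorphisms can be composed
  and inverted as relations, without tracking their domains.\<close>

section \<open>Relations compatible with the ring operations\<close>

text \<open>A unital subring of the product ring \<open>complex \<times> complex\<close>.
  Single-valuedness is left to a separate condition, so that relations not yet known to be functions
  are covered too.\<close>

definition subring_rel :: "(complex \<times> complex) set \<Rightarrow> bool" where
  "subring_rel S \<longleftrightarrow> (1, 1) \<in> S \<and>
    (\<forall>x y u v. (x, y) \<in> S \<longrightarrow> (u, v) \<in> S \<longrightarrow>
      (x + u, y + v) \<in> S \<and> (x - u, y - v) \<in> S \<and> (x * u, y * v) \<in> S)"

lemma subring_relI:
  assumes "(1, 1) \<in> S"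
    and "\<And>x y u v. (x, y) \<in> S \<Longrightarrow> (u, v) \<in> S \<Longrightarrow> (x + u, y + v) \<in> S"
    and "\<And>x y u v. (x, y) \<in> S \<Longrightarrow> (u, v) \<in> S \<Longrightarrow> (x - u, y - v) \<in> S"
    and "\<And>x y u v. (x, y) \<in> S \<Longrightarrow> (u, v) \<in> S \<Longrightarrow> (x * u, y * v) \<in> S"
  shows "subring_rel S"
  using assms by (simp add: subring_rel_def)

lemma subring_rel_ops:
  assumes "subring_rel S"
  shows "(1, 1) \<in> S"
    and "(x, y) \<in> S \<Longrightarrow> (u, v) \<in> S \<Longrightarrow> (x + u, y + v) \<in> S"
    and "(x, y) \<in> S \<Longrightarrow> (u, v) \<in> S \<Longrightarrow> (x - u, y - v) \<in> S"
    and "(x, y) \<in> S \<Longrightarrow> (u, v) \<in> S \<Longrightarrow> (x * u, y * v) \<in> S"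
  using assms by (simp_all add: subring_rel_def)

lemma subring_rel_zero: "subring_rel S \<Longrightarrow> (0, 0) \<in> S"
  using subring_rel_ops(3)[of S 1 1 1 1] subring_rel_ops(1)[of S] by simp

lemma subring_rel_sum:
  assumes "subring_rel S" "\<And>i. i \<in> I \<Longrightarrow> (f i, g i) \<in> S"
  shows "(sum f I, sum g I) \<in> S"
  using assms(2)
proof (induction I rule: infinite_finite_induct)
  case (insert i I)
  then show ?case using subring_rel_ops(2)[OF assms(1)] by simp
qed (use subring_rel_zero[OF assms(1)] in auto)

lemma subring_rel_power:
  assumes "subring_rel S" "(x, y) \<in> S"
  shows "(x ^ k, y ^ k) \<in> S"
  by (induction k) (use subring_rel_ops[OF assms(1)] assms(2) in auto)

lemma subring_rel_converse: "subring_rel S \<Longrightarrow> subring_rel (S\<inverse>)"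
  by (simp add: subring_rel_def)

lemma subring_rel_comp:
  assumes "subring_rel S" "subring_rel T"
  shows "subring_rel (S O T)"
proof (rule subring_relI)
  show "(1, 1) \<in> S O T" using assms by (blast intro: subring_rel_ops(1))
  fix x y u v assume "(x, y) \<in> S O T" "(u, v) \<in> S O T"
  then obtain a b where ab: "(x, a) \<in> S" "(u, b) \<in> S" "(a, y) \<in> T" "(b, v) \<in> T" by blast
  show "(x + u, y + v) \<in> S O T" "(x - u, y - v) \<in> S O T" "(x * u, y * v) \<in> S O T"
    using subring_rel_ops(2-4)[OF assms(1) ab(1,2)] subring_rel_ops(2-4)[OF assms(2) ab(3,4)]
    by auto
qed

section \<open>Polynomials with related coefficients\<close>

text \<open>For a partial isomorphism this is the graph of the induced isomorphism of polynomial
  rings.\<close>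

definition poly_rel :: "(complex \<times> complex) set \<Rightarrow> (complex poly \<times> complex poly) set" where
  "poly_rel S = {(p, q). \<forall>i. (coeff p i, coeff q i) \<in> S}"

lemma poly_rel_iff: "(p, q) \<in> poly_rel S \<longleftrightarrow> (\<forall>i. (coeff p i, coeff q i) \<in> S)"
  by (simp add: poly_rel_def)

lemma poly_rel_ops:
  assumes "subring_rel S" "(p, q) \<in> poly_rel S" "(s, t) \<in> poly_rel S"
  shows "(p + s, q + t) \<in> poly_rel S" "(p - s, q - t) \<in> poly_rel S" "(p * s, q * t) \<in> poly_rel S"
  using assms(2,3)
  by (auto simp: poly_rel_iff coeff_mult intro!: subring_rel_ops[OF assms(1)] subring_rel_sum[OF assms(1)])

lemma poly_rel_monom:
  "subring_rel S \<Longrightarrow> (c, d) \<in> S \<Longrightarrow> (monom c k, monom d k) \<in> poly_rel S"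
  by (auto simp: poly_rel_iff coeff_monom subring_rel_zero)

lemma poly_rel_prod:
  assumes "subring_rel S" "finite I" "\<And>i. i \<in> I \<Longrightarrow> (f i, g i) \<in> poly_rel S"
  shows "(prod f I, prod g I) \<in> poly_rel S"
  using assms(2,3)
proof (induction I)
  case empty
  have "(monom 1 0, monom 1 0) \<in> poly_rel S"
    by (intro poly_rel_monom subring_rel_ops(1) assms(1))
  then show ?case by simp
next
  case (insert i I)
  then have "(f i * prod f I, g i * prod g I) \<in> poly_rel S"
    by (intro poly_rel_ops(3)[OF assms(1)]) simp_all
  then show ?case using insert.hyps by simp
qed

lemma poly_rel_converse: "poly_rel (S\<inverse>) = (poly_rel S)\<inverse>"
  by (auto simp: poly_rel_iff)

section \<open>Simple extensions and partial isomorphisms\<close>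

text \<open>For a subring \<open>S\<close>, the subring generated by \<open>S\<close> and
  \<open>(z, w)\<close>: the candidate for extending \<open>S\<close> by
  \<open>z \<mapsto> w\<close>. It is a partial isomorphism exactly if related polynomials vanish
  simultaneously, one at \<open>z\<close> and the other at \<open>w\<close>.\<close>

definition adjoin :: "(complex \<times> complex) set \<Rightarrow> complex \<Rightarrow> complex \<Rightarrow> (complex \<times> complex) set" where
  "adjoin S z w = {(poly p z, poly q w) | p q. (p, q) \<in> poly_rel S}"

lemma adjoinI: "(p, q) \<in> poly_rel S \<Longrightarrow> x = poly p z \<Longrightarrow> y = poly q w \<Longrightarrow> (x, y) \<in> adjoin S z w"
  by (auto simp: adjoin_def)

lemma adjoin_base:
  assumes "subring_rel S"
  shows "S \<subseteq> adjoin S z w"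
proof clarify
  fix a b assume "(a, b) \<in> S"
  then show "(a, b) \<in> adjoin S z w"
    by (intro adjoinI[OF poly_rel_monom[OF assms, of a b 0]]) (auto simp: poly_monom)
qed

lemma adjoin_new: "subring_rel S \<Longrightarrow> (z, w) \<in> adjoin S z w"
  by (intro adjoinI[OF poly_rel_monom[OF _ subring_rel_ops(1), of S 1]]) (auto simp: poly_monom)

lemma subring_rel_adjoin:
  assumes "subring_rel S"
  shows "subring_rel (adjoin S z w)"
proof (rule subring_relI)
  show "(1, 1) \<in> adjoin S z w"
    using adjoin_base[OF assms] subring_rel_ops(1)[OF assms] by blast
next
  fix x y u v assume "(x, y) \<in> adjoin S z w" "(u, v) \<in> adjoin S z w"
  then obtain p q s t where pq: "(p, q) \<in> poly_rel S" "(s, t) \<in> poly_rel S"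
    and eq: "x = poly p z" "y = poly q w" "u = poly s z" "v = poly t w"
    unfolding adjoin_def by blast
  note ops = poly_rel_ops[OF assms pq]
  show "(x + u, y + v) \<in> adjoin S z w" using adjoinI[OF ops(1)] eq by simp
  show "(x - u, y - v) \<in> adjoin S z w" using adjoinI[OF ops(2)] eq by simp
  show "(x * u, y * v) \<in> adjoin S z w" using adjoinI[OF ops(3)] eq by simp
qed

text \<open>By subtraction the condition makes \<open>S\<close> single-valued and injective, so \<open>S\<close> is the
  graph of an isomorphism between two subrings of the complex numbers.\<close>
definition partial_iso :: "(complex \<times> complex) set \<Rightarrow> bool" where
  "partial_iso S \<longleftrightarrow> subring_rel S \<and> (\<forall>x y. (x, y) \<in> S \<longrightarrow> (x = 0 \<longleftrightarrow> y = 0))"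

lemma partial_isoD:
  assumes "partial_iso S"
  shows "subring_rel S" "(x, y) \<in> S \<Longrightarrow> x = 0 \<longleftrightarrow> y = 0"
  using assms by (auto simp: partial_iso_def)

lemma partial_iso_converse: "partial_iso S \<Longrightarrow> partial_iso (S\<inverse>)"
  by (auto simp: partial_iso_def subring_rel_converse)

lemma partial_iso_comp: "partial_iso S \<Longrightarrow> partial_iso T \<Longrightarrow> partial_iso (S O T)"
  by (auto simp: partial_iso_def subring_rel_comp)

lemma partial_iso_unique:
  assumes "partial_iso S" "(x, y) \<in> S" "(x, y') \<in> S"
  shows "y = y'"
  using subring_rel_ops(3)[OF partial_isoD(1)[OF assms(1)] assms(2,3)]
    partial_isoD(2)[OF assms(1), of "x - x" "y - y'"] by simp

lemma poly_rel_degree: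
  assumes "partial_iso S" "(p, q) \<in> poly_rel S"
  shows "degree p = degree q" "p = 0 \<longleftrightarrow> q = 0"
proof -
  have *: "coeff p i = 0 \<longleftrightarrow> coeff q i = 0" for i
    using assms(2) partial_isoD(2)[OF assms(1)] by (auto simp: poly_rel_iff)
  then show "degree p = degree q" by (simp add: degree_def)
  show "p = 0 \<longleftrightarrow> q = 0" using * by (auto simp: poly_eq_iff)
qed

section \<open>Maximal partial isomorphisms and algebraic elements\<close>

definition maximal_iso :: "(complex \<times> complex) set \<Rightarrow> bool" where
  "maximal_iso S \<longleftrightarrow> partial_iso S \<and> (\<forall>T. partial_iso T \<longrightarrow> S \<subseteq> T \<longrightarrow> T = S)"

text \<open>Zorn's lemma applies because every condition on a partial isomorphism involves at most
  two of its pairs, and two pairs from the union of a chain lie in a common member.\<close>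

lemma maximal_iso_exists:
  assumes "partial_iso S"
  obtains T where "maximal_iso T" "S \<subseteq> T"
proof -
  let ?A = "{T. partial_iso T \<and> S \<subseteq> T}"
  have "\<exists>M\<in>?A. \<forall>X\<in>?A. M \<subseteq> X \<longrightarrow> X = M"
  proof (rule subset_Zorn_nonempty)
    show "?A \<noteq> {}" using assms by blast
  next
    fix C assume C: "C \<noteq> {}" "subset.chain ?A C"
    have iso: "partial_iso T" "S \<subseteq> T" if "T \<in> C" for T
      using C(2) that by (auto simp: subset_chain_def)
    have common: "\<exists>T\<in>C. p \<in> T \<and> q \<in> T" if "p \<in> \<Union>C" "q \<in> \<Union>C" for p q
      using C(2) that unfolding subset_chain_def by blast
    have ops: "(x + u, y + v) \<in> \<Union>C" "(x - u, y - v) \<in> \<Union>C" "(x * u, y * v) \<in> \<Union>C"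
      if xy: "(x, y) \<in> \<Union>C" "(u, v) \<in> \<Union>C" for x y u v
    proof -
      obtain T where T: "T \<in> C" "(x, y) \<in> T" "(u, v) \<in> T" using common[OF xy] by blast
      note subring_rel_ops(2-4)[OF partial_isoD(1)[OF iso(1)[OF T(1)]] T(2,3)]
      then show "(x + u, y + v) \<in> \<Union>C" "(x - u, y - v) \<in> \<Union>C" "(x * u, y * v) \<in> \<Union>C"
        using T(1) by blast+
    qed
    have "subring_rel (\<Union>C)"
    proof (rule subring_relI)
      show "(1, 1) \<in> \<Union>C"
        using C(1) subring_rel_ops(1)[OF partial_isoD(1)[OF iso(1)]] by blast
    qed (fact ops)+
    moreover have "x = 0 \<longleftrightarrow> y = 0" if "(x, y) \<in> \<Union>C" for x y
      using that partial_isoD(2)[OF iso(1)] by (elim UnionE)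
    ultimately have "partial_iso (\<Union>C)" unfolding partial_iso_def by blast
    then show "\<Union>C \<in> ?A" using C(1) iso(2) by blast
  qed
  then obtain M where M: "partial_iso M" "S \<subseteq> M" "\<forall>X\<in>?A. M \<subseteq> X \<longrightarrow> X = M" by blast
  then have "maximal_iso M" unfolding maximal_iso_def by blast
  with M(2) show ?thesis using that by blast
qed

text \<open>This symmetry carries every result about domains over to ranges.\<close>

lemma maximal_iso_converse:
  assumes "maximal_iso S"
  shows "maximal_iso (S\<inverse>)"
proof -
  have "T = S\<inverse>" if "partial_iso T" "S\<inverse> \<subseteq> T" for T
  proof -
    have "S \<subseteq> T\<inverse>" using that(2) by auto
    then have "T\<inverse> = S"
      using assms partial_iso_converse[OF that(1)] unfolding maximal_iso_def by blast
    then show ?thesis by auto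
  qed
  then show ?thesis
    using assms partial_iso_converse unfolding maximal_iso_def by blast
qed

lemma maximal_iso_adjoin:
  assumes "maximal_iso S" "partial_iso (adjoin S z w)"
  shows "(z, w) \<in> S"
proof -
  have S: "subring_rel S" using assms(1) by (simp add: maximal_iso_def partial_iso_def)
  have "adjoin S z w = S"
    using assms adjoin_base[OF S] unfolding maximal_iso_def by blast
  then show ?thesis using adjoin_new[OF S] by blast
qed

text \<open>The condition \<open>u \<noteq> 0\<close> suffices: in a partial isomorphism it forces
  \<open>v \<noteq> 0\<close>.\<close>

definition fractions :: "(complex \<times> complex) set \<Rightarrow> (complex \<times> complex) set" where
  "fractions S = {(x / u, y / v) | x y u v. (x, y) \<in> S \<and> (u, v) \<in> S \<and> u \<noteq> 0}"

lemma fractionsI: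
  "(x, y) \<in> S \<Longrightarrow> (u, v) \<in> S \<Longrightarrow> u \<noteq> 0 \<Longrightarrow> a = x / u \<Longrightarrow> b = y / v \<Longrightarrow> (a, b) \<in> fractions S"
  unfolding fractions_def by blast

lemma partial_iso_fractions:
  assumes "partial_iso S"
  shows "partial_iso (fractions S)"
  unfolding partial_iso_def
proof (intro conjI subring_relI allI impI)
  note ops = subring_rel_ops[OF partial_isoD(1)[OF assms]]
  show "(1, 1) \<in> fractions S" by (rule fractionsI[OF ops(1) ops(1)]) auto
  fix a b assume "(a, b) \<in> fractions S"
  then obtain x y u v where 1: "(x, y) \<in> S" "(u, v) \<in> S" "u \<noteq> 0" "a = x / u" "b = y / v"
    unfolding fractions_def by blast
  have v: "v \<noteq> 0" using 1 partial_isoD(2)[OF assms] by blast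
  show "a = 0 \<longleftrightarrow> b = 0" using 1 v partial_isoD(2)[OF assms 1(1)] by simp
  fix c d assume "(c, d) \<in> fractions S"
  then obtain x' y' u' v' where 2: "(x', y') \<in> S" "(u', v') \<in> S" "u' \<noteq> 0" "c = x' / u'" "d = y' / v'"
    unfolding fractions_def by blast
  have v': "v' \<noteq> 0" using 2 partial_isoD(2)[OF assms] by blast
  have uu: "(u * u', v * v') \<in> S" "u * u' \<noteq> 0" using 1 2 ops(4) by auto
  show "(a + c, b + d) \<in> fractions S"
    by (rule fractionsI[OF ops(2)[OF ops(4)[OF 1(1) 2(2)] ops(4)[OF 2(1) 1(2)]] uu])
      (use 1(3) 2(3) v v' in \<open>simp_all add: 1(4,5) 2(4,5) add_frac_eq diff_frac_eq\<close>)
  show "(a - c, b - d) \<in> fractions S"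
    by (rule fractionsI[OF ops(3)[OF ops(4)[OF 1(1) 2(2)] ops(4)[OF 2(1) 1(2)]] uu])
      (use 1(3) 2(3) v v' in \<open>simp_all add: 1(4,5) 2(4,5) add_frac_eq diff_frac_eq\<close>)
  show "(a * c, b * d) \<in> fractions S"
    by (rule fractionsI[OF ops(4)[OF 1(1) 2(1)] uu]) (simp_all add: 1(4,5) 2(4,5))
qed

text \<open>The fractions form a partial isomorphism containing \<open>S\<close>, so by maximality
  they are \<open>S\<close> itself; in particular the domain is a field.\<close>

lemma maximal_iso_divide:
  assumes "maximal_iso S" "(x, y) \<in> S" "(u, v) \<in> S" "u \<noteq> 0"
  shows "(x / u, y / v) \<in> S"
proof -
  have S: "partial_iso S" using assms(1) by (simp add: maximal_iso_def)
  have "(a, b) \<in> fractions S" if "(a, b) \<in> S" for a b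
    by (rule fractionsI[OF that subring_rel_ops(1)[OF partial_isoD(1)[OF S]]]) auto
  then have "S \<subseteq> fractions S" by (rule subrelI)
  then have "fractions S = S"
    using assms(1) partial_iso_fractions[OF S] unfolding maximal_iso_def by blast
  then show ?thesis using fractionsI[OF assms(2,3,4) refl refl] by simp
qed

text \<open>Division with remainder runs in parallel on both sides: related polynomials have equal
  degrees, and the quotients of their leading coefficients are related again.\<close>

lemma poly_rel_division:
  assumes "maximal_iso S" "(b, b') \<in> poly_rel S" "b \<noteq> 0" "(f, f') \<in> poly_rel S"
  shows "\<exists>s s' t t'. (s, s') \<in> poly_rel S \<and> (t, t') \<in> poly_rel S \<and>
    f = b * s + t \<and> f' = b' * s' + t' \<and> (t = 0 \<or> degree t < degree b)"
  using assms(4)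
proof (induction "degree f" arbitrary: f f' rule: less_induct)
  case less
  have iso: "partial_iso S" using assms(1) by (simp add: maximal_iso_def)
  note S = partial_isoD(1)[OF iso]
  have zero: "(0, 0) \<in> poly_rel S" by (simp add: poly_rel_iff subring_rel_zero[OF S])
  show ?case
  proof (cases "f = 0 \<or> degree f < degree b")
    case True
    then show ?thesis using zero less.prems by (intro exI[of _ 0] exI[of _ f] exI[of _ f']) auto
  next
    case False
    let ?k = "degree f - degree b"
    let ?c = "lead_coeff f / lead_coeff b" and ?c' = "lead_coeff f' / lead_coeff b'"
    let ?m = "monom ?c ?k" and ?m' = "monom ?c' ?k"
    have deg: "degree f' = degree f" "degree b' = degree b" "b' \<noteq> 0"
      using poly_rel_degree[OF iso less.prems] poly_rel_degree[OF iso assms(2)] assms(3) by auto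
    have "(?c, ?c') \<in> S"
      using less.prems assms(2,3) deg
      by (intro maximal_iso_divide[OF assms(1)]) (auto simp: poly_rel_iff)
    then have m: "(?m, ?m') \<in> poly_rel S" by (rule poly_rel_monom[OF S])
    let ?g = "f - b * ?m" and ?g' = "f' - b' * ?m'"
    have g: "(?g, ?g') \<in> poly_rel S"
      by (intro poly_rel_ops[OF S] less.prems assms(2) m)
    have degm: "degree (b * ?m) = degree f"
      using False assms(3) by (subst degree_mult_eq) (auto simp: degree_monom_eq)
    have "lead_coeff (b * ?m) = lead_coeff b * ?c"
      by (simp only: lead_coeff_mult lead_coeff_monom)
    then have "lead_coeff (b * ?m) = coeff f (degree f)" using assms(3) by simp
    then have "coeff ?g (degree f) = 0" using degm by simp
    moreover have "degree ?g \<le> degree f" using degree_diff_le_max[of f "b * ?m"] degm by simp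
    ultimately have "?g = 0 \<or> degree ?g < degree f"
      by (metis leading_coeff_0_iff le_neq_implies_less)
    then have "\<exists>s s' t t'. (s, s') \<in> poly_rel S \<and> (t, t') \<in> poly_rel S \<and>
      ?g = b * s + t \<and> ?g' = b' * s' + t' \<and> (t = 0 \<or> degree t < degree b)"
    proof
      assume "?g = 0"
      moreover have "?g' = 0" using poly_rel_degree(2)[OF iso g] calculation by simp
      ultimately show ?thesis using zero by (intro exI[of _ 0]) auto
    next
      assume "degree ?g < degree f"
      then show ?thesis using less.hyps g by blast
    qed
    then obtain s s' t t' where st: "(s, s') \<in> poly_rel S" "(t, t') \<in> poly_rel S"
      "?g = b * s + t" "?g' = b' * s' + t'" "t = 0 \<or> degree t < degree b" by blast
    have "f = b * (?m + s) + t" "f' = b' * (?m' + s') + t'"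
      using st(3,4) by (simp_all add: algebra_simps)
    then show ?thesis using poly_rel_ops(1)[OF S m st(1)] st(2,5) by blast
  qed
qed

text \<open>Here \<open>p\<close> is a minimal polynomial of \<open>z\<close> over the domain. It
  divides \<open>f\<close>, so \<open>p'\<close> divides \<open>f'\<close>, and the root
  \<open>w\<close> of \<open>p'\<close> is a root of \<open>f'\<close>. This is one direction of the
  condition for \<open>adjoin S z w\<close> to be a partial isomorphism.\<close>

lemma adjoin_root_zero:
  assumes "maximal_iso S" "(p, p') \<in> poly_rel S" "p \<noteq> 0" "poly p' w = 0"
    and min: "\<And>q q'. (q, q') \<in> poly_rel S \<Longrightarrow> q \<noteq> 0 \<Longrightarrow> degree q < degree p \<Longrightarrow> poly q z \<noteq> 0"
    and "poly p z = 0" "(f, f') \<in> poly_rel S" "poly f z = 0"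
  shows "poly f' w = 0"
proof -
  have iso: "partial_iso S" using assms(1) by (simp add: maximal_iso_def)
  obtain s s' t t' where st: "(s, s') \<in> poly_rel S" "(t, t') \<in> poly_rel S"
    "f = p * s + t" "f' = p' * s' + t'" "t = 0 \<or> degree t < degree p"
    using poly_rel_division[OF assms(1,2,3,7)] by blast
  have "poly t z = 0" using assms(6,8) st(3) by simp
  then have "t = 0" using min[OF st(2)] st(5) by blast
  then have "t' = 0" using poly_rel_degree(2)[OF iso st(2)] by simp
  then show ?thesis using st(4) assms(4) by simp
qed

lemma degree_nonzero_of_root:
  fixes p :: "'a::comm_semiring_1 poly"
  assumes "p \<noteq> 0" "poly p z = 0"
  shows "degree p \<noteq> 0"
proof
  assume "degree p = 0"
  then obtain c where "p = [:c:]" by (rule degree_eq_zeroE)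
  then show False using assms by simp
qed

text \<open>Extend \<open>S\<close> by sending \<open>z\<close> to a root of the image of its minimal polynomial \<open>p\<close>. The image of
  \<open>p\<close> is minimal too, because a proper factor would be the image of a proper factor of \<open>p\<close>; so the
  situation is symmetric in \<open>S\<close> and its converse.\<close>
lemma maximal_iso_algebraic:
  assumes "maximal_iso S" "(g, g') \<in> poly_rel S" "g \<noteq> 0" "poly g z = 0"
  shows "z \<in> Domain S"
proof -
  have iso: "partial_iso S" using assms(1) by (simp add: maximal_iso_def)
  note S = partial_isoD(1)[OF iso]
  let ?P = "\<lambda>p. p \<noteq> 0 \<and> poly p z = 0 \<and> (\<exists>p'. (p, p') \<in> poly_rel S)"
  have "\<exists>p. ?P p \<and> (\<forall>q. ?P q \<longrightarrow> degree p \<le> degree q)"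
    using ex_has_least_nat[of ?P g degree] assms(2-4) by blast
  then obtain p p' where p: "p \<noteq> 0" "poly p z = 0" "(p, p') \<in> poly_rel S"
    and least: "\<And>q. ?P q \<Longrightarrow> degree p \<le> degree q" by blast
  have min: "poly q z \<noteq> 0" if "(q, q') \<in> poly_rel S" "q \<noteq> 0" "degree q < degree p" for q q'
    using least[of q] that by fastforce
  have p': "p' \<noteq> 0" "degree p' = degree p" using poly_rel_degree[OF iso p(3)] p(1) by auto
  have "degree p \<noteq> 0" by (rule degree_nonzero_of_root[OF p(1,2)])
  then have "\<not> constant (poly p')" using p'(2) by (simp add: constant_degree)
  then obtain w where w: "poly p' w = 0" using fundamental_theorem_of_algebra by blast
  have min': "poly q' w \<noteq> 0"
    if q: "(q', q) \<in> poly_rel (S\<inverse>)" and "q' \<noteq> 0" "degree q' < degree p'" for q q'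
  proof
    assume "poly q' w = 0"
    let ?P' = "\<lambda>p. p \<noteq> 0 \<and> poly p w = 0 \<and> degree p < degree p' \<and> (\<exists>q. (p, q) \<in> poly_rel (S\<inverse>))"
    \<comment> \<open>Choose an annihilator of \<open>w\<close> of least degree over the range.
      Below, the unprimed \<open>h\<close> lies on the side of \<open>w\<close> and
      \<open>h'\<close> on the side of \<open>z\<close>, the reverse of \<open>p\<close> and
      \<open>p'\<close>.\<close>
    have "\<exists>h. ?P' h \<and> (\<forall>q. ?P' q \<longrightarrow> degree h \<le> degree q)"
      using ex_has_least_nat[of ?P' q' degree] that \<open>poly q' w = 0\<close> by blast
    then obtain h h' where h: "h \<noteq> 0" "poly h w = 0" "degree h < degree p'" "(h, h') \<in> poly_rel (S\<inverse>)"
      and hmin: "\<And>q. ?P' q \<Longrightarrow> degree h \<le> degree q" by blast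
    have m: "poly q w \<noteq> 0" if "(q, q') \<in> poly_rel (S\<inverse>)" "q \<noteq> 0" "degree q < degree h" for q q'
      using hmin[of q] that h(3) by fastforce
    obtain s s' t t' where st: "(s, s') \<in> poly_rel (S\<inverse>)" "(t, t') \<in> poly_rel (S\<inverse>)"
      "p' = h * s + t" "p = h' * s' + t'" "t = 0 \<or> degree t < degree h"
      using poly_rel_division[OF maximal_iso_converse[OF assms(1)] h(4,1), of p' p] p(3)
      unfolding poly_rel_converse by blast
    have "poly t w = 0" using w h(2) st(3) by simp
    then have "t = 0" using m[OF st(2)] st(5) by blast
    then have "t' = 0" using poly_rel_degree(2)[OF partial_iso_converse[OF iso] st(2)] by simp
    have ph: "p = h' * s'" using st(4) \<open>t' = 0\<close> by simp
    have "h' \<noteq> 0" "s' \<noteq> 0" using p(1) ph by auto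
    have "degree h' = degree h"
      using poly_rel_degree(1)[OF partial_iso_converse[OF iso] h(4)] by simp
    moreover have "degree h \<noteq> 0" by (rule degree_nonzero_of_root[OF h(1,2)])
    moreover have "degree p = degree h' + degree s'"
      using ph \<open>h' \<noteq> 0\<close> \<open>s' \<noteq> 0\<close> by (simp add: degree_mult_eq)
    ultimately have "degree h' < degree p" "degree s' < degree p" using h(3) p'(2) by linarith+
    then have "poly h' z \<noteq> 0" "poly s' z \<noteq> 0"
      using min \<open>h' \<noteq> 0\<close> \<open>s' \<noteq> 0\<close> h(4) st(1) unfolding poly_rel_converse by blast+
    then show False using p(2) ph by simp
  qed
  have "partial_iso (adjoin S z w)"
    unfolding partial_iso_def
  proof (intro conjI subring_rel_adjoin[OF S] allI impI)
    fix x y assume "(x, y) \<in> adjoin S z w"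
    then obtain f f' where f: "(f, f') \<in> poly_rel S" "x = poly f z" "y = poly f' w"
      unfolding adjoin_def by blast
    have cp: "(p', p) \<in> poly_rel (S\<inverse>)" "(f', f) \<in> poly_rel (S\<inverse>)"
      using p(3) f(1) unfolding poly_rel_converse by auto
    have "poly f' w = 0" if "poly f z = 0"
      by (rule adjoin_root_zero[OF assms(1) p(3,1) w _ p(2) f(1) that]) (rule min; assumption)
    moreover have "poly f z = 0" if "poly f' w = 0"
      by (rule adjoin_root_zero[OF maximal_iso_converse[OF assms(1)] cp(1) p'(1) p(2) _ w cp(2) that])
        (rule min'; assumption)
    ultimately show "x = 0 \<longleftrightarrow> y = 0" unfolding f(2,3) by blast
  qed
  then show ?thesis using maximal_iso_adjoin[OF assms(1)] by blast
qed

text \<open>The number \<open>r\<close> is a root of \<open>X ^ m - r ^ m\<close>, whose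
  coefficients lie in the domain.\<close>

lemma maximal_iso_root:
  assumes "maximal_iso S" "r ^ m \<in> Domain S" "m > 0"
  shows "r \<in> Domain S"
proof -
  have S: "subring_rel S" using assms(1) by (simp add: maximal_iso_def partial_iso_def)
  obtain y where y: "(r ^ m, y) \<in> S" using assms(2) by blast
  have "(monom 1 m - monom (r ^ m) 0, monom 1 m - monom y 0) \<in> poly_rel S"
    by (intro poly_rel_ops poly_rel_monom S y subring_rel_ops)
  \<comment> \<open>As \<open>m > 0\<close>, the constant term does not touch the leading
    coefficient.\<close>
  moreover have "coeff (monom 1 m - monom (r ^ m) 0) m = 1"
    using assms(3) by (simp add: coeff_monom)
  then have "monom 1 m - monom (r ^ m) 0 \<noteq> 0" by (metis coeff_0 zero_neq_one)
  ultimately show ?thesis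
    by (rule maximal_iso_algebraic[OF assms(1)]) (simp add: poly_monom)
qed

section \<open>Isomorphisms between fields closed under radicals\<close>

definition unity_roots :: "complex set" where
  "unity_roots = {\<zeta>. \<exists>m>0. \<zeta> ^ m = 1}"

lemma countable_unity_roots: "countable unity_roots"
proof -
  have eq: "unity_roots = (\<Union>m\<in>{0<..}. {\<zeta>. \<zeta> ^ m = 1})"
    by (auto simp: unity_roots_def)
  have "countable {\<zeta>::complex. \<zeta> ^ m = 1}" if "m > 0" for m :: nat
    using that by (intro countable_finite finite_roots_unity) simp
  then show ?thesis unfolding eq by (intro countable_UN) auto
qed

text \<open>Besides fixing the roots of unity, this records consequences of maximality that survive
  composition. Maximality itself need not survive, since composing can shrink domain and
  range.\<close>

definition radical_iso :: "(complex \<times> complex) set \<Rightarrow> bool" where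
  "radical_iso S \<longleftrightarrow> partial_iso S \<and> Id_on unity_roots \<subseteq> S \<and>
    (\<forall>x y u v. (x, y) \<in> S \<longrightarrow> (u, v) \<in> S \<longrightarrow> u \<noteq> 0 \<longrightarrow> (x / u, y / v) \<in> S) \<and>
    (\<forall>r m. m > 0 \<longrightarrow> r ^ m \<in> Domain S \<longrightarrow> r \<in> Domain S) \<and>
    (\<forall>r m. m > 0 \<longrightarrow> r ^ m \<in> Range S \<longrightarrow> r \<in> Range S)"

lemma radical_isoD:
  assumes "radical_iso S"
  shows "partial_iso S" "\<zeta> \<in> unity_roots \<Longrightarrow> (\<zeta>, \<zeta>) \<in> S"
    "(x, y) \<in> S \<Longrightarrow> (u, v) \<in> S \<Longrightarrow> u \<noteq> 0 \<Longrightarrow> (x / u, y / v) \<in> S"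
    "m > 0 \<Longrightarrow> r ^ m \<in> Domain S \<Longrightarrow> r \<in> Domain S"
    "m > 0 \<Longrightarrow> r ^ m \<in> Range S \<Longrightarrow> r \<in> Range S"
  using assms by (auto simp: radical_iso_def)

lemma radical_iso_ops:
  assumes "radical_iso S"
  shows "(x, y) \<in> S \<Longrightarrow> (u, v) \<in> S \<Longrightarrow> (x + u, y + v) \<in> S"
    "(x, y) \<in> S \<Longrightarrow> (u, v) \<in> S \<Longrightarrow> (x - u, y - v) \<in> S"
    "(x, y) \<in> S \<Longrightarrow> (u, v) \<in> S \<Longrightarrow> (x * u, y * v) \<in> S"
    "(x, y) \<in> S \<Longrightarrow> (x ^ k, y ^ k) \<in> S"
  using subring_rel_ops(2-4) subring_rel_power partial_isoD(1)[OF radical_isoD(1)[OF assms]]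
  by simp_all

text \<open>Any maximal extension will do; radicals in its range are radicals in the domain of its
  converse.\<close>

lemma radical_iso_extension:
  assumes "partial_iso S" "Id_on unity_roots \<subseteq> S"
  obtains T where "radical_iso T" "S \<subseteq> T"
proof -
  obtain T where T: "maximal_iso T" "S \<subseteq> T" using maximal_iso_exists[OF assms(1)] .
  have "radical_iso T"
    unfolding radical_iso_def
  proof (intro conjI allI impI)
    show "partial_iso T" using T(1) by (simp add: maximal_iso_def)
    show "Id_on unity_roots \<subseteq> T" using assms(2) T(2) by blast
    show "r \<in> Range T" if "m > 0" "r ^ m \<in> Range T" for r m
      using maximal_iso_root[OF maximal_iso_converse[OF T(1)]] that by auto
  qed (use maximal_iso_divide[OF T(1)] maximal_iso_root[OF T(1)] in auto)
  then show ?thesis using that T(2) by blast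
qed

lemma radical_iso_converse:
  assumes "radical_iso S"
  shows "radical_iso (S\<inverse>)"
  unfolding radical_iso_def
proof (intro conjI allI impI)
  show "partial_iso (S\<inverse>)" by (rule partial_iso_converse[OF radical_isoD(1)[OF assms]])
  show "Id_on unity_roots \<subseteq> S\<inverse>" using radical_isoD(2)[OF assms] by blast
  show "(x / u, y / v) \<in> S\<inverse>" if "(x, y) \<in> S\<inverse>" "(u, v) \<in> S\<inverse>" "u \<noteq> 0" for x y u v
    using that radical_isoD(3)[OF assms] partial_isoD(2)[OF radical_isoD(1)[OF assms]] by blast
qed (use radical_isoD(4,5)[OF assms] in auto)

text \<open>For radicals: if \<open>S\<close> sends \<open>r ^ m\<close> to some \<open>a\<close> in
  the domain of \<open>T\<close>, it sends \<open>r\<close> to some \<open>s\<close> with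
  \<open>s ^ m = a\<close> by uniqueness of images, so \<open>s\<close> is in the domain of
  \<open>T\<close>. The range is treated in the same way from the other end.\<close>

lemma radical_iso_comp:
  assumes S: "radical_iso S" and T: "radical_iso T"
  shows "radical_iso (S O T)"
  unfolding radical_iso_def
proof (intro conjI allI impI)
  show "partial_iso (S O T)" by (intro partial_iso_comp radical_isoD(1) assms)
  show "Id_on unity_roots \<subseteq> S O T" using radical_isoD(2) assms by blast
  show "(x / u, y / v) \<in> S O T" if xy: "(x, y) \<in> S O T" "(u, v) \<in> S O T" "u \<noteq> 0" for x y u v
  proof -
    obtain a b where "(x, a) \<in> S" "(a, y) \<in> T" "(u, b) \<in> S" "(b, v) \<in> T" using xy by blast
    moreover have "b \<noteq> 0"
      using \<open>(u, b) \<in> S\<close> xy(3) partial_isoD(2)[OF radical_isoD(1)[OF S]] by blast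
    ultimately show ?thesis using xy(3) radical_isoD(3) assms by blast
  qed
  show "r \<in> Domain (S O T)" if m: "m > 0" "r ^ m \<in> Domain (S O T)" for r m
  proof -
    obtain a where a: "(r ^ m, a) \<in> S" "a \<in> Domain T" using m(2) by blast
    obtain s where s: "(r, s) \<in> S" using radical_isoD(4)[OF S m(1)] a(1) by blast
    have "a = s ^ m"
      using partial_iso_unique[OF radical_isoD(1)[OF S] a(1)] radical_iso_ops(4)[OF S s] by blast
    then have "s \<in> Domain T" using radical_isoD(4)[OF T m(1)] a(2) by blast
    then show ?thesis using s by blast
  qed
  show "r \<in> Range (S O T)" if m: "m > 0" "r ^ m \<in> Range (S O T)" for r m
  proof -
    obtain a where a: "(a, r ^ m) \<in> T" "a \<in> Range S" using m(2) by blast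
    obtain s where s: "(s, r) \<in> T" using radical_isoD(5)[OF T m(1)] a(1) by blast
    have "a = s ^ m"
      using partial_iso_unique[OF partial_iso_converse[OF radical_isoD(1)[OF T]], of "r ^ m" a "s ^ m"]
        a(1) radical_iso_ops(4)[OF T s] by simp
    then have "s \<in> Range S" using radical_isoD(5)[OF S m(1)] a(2) by blast
    then show ?thesis using s by blast
  qed
qed

text \<open>Both isomorphisms multiply \<open>r\<close> by a root of unity, which they fix; so they commute
  on \<open>r\<close>.\<close>
lemma commutator_fixes_radical:
  assumes S: "radical_iso S" and T: "radical_iso T"
    and "(r ^ m, r ^ m) \<in> S" "(r ^ m, r ^ m) \<in> T" "m > 0"
  shows "(r, r) \<in> S O T O S\<inverse> O T\<inverse>"
proof -
  have move: "\<exists>\<zeta>\<in>unity_roots. (r, \<zeta> * r) \<in> R" if R: "radical_iso R" "(r ^ m, r ^ m) \<in> R" for R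
  proof -
    obtain s where s: "(r, s) \<in> R" using radical_isoD(4)[OF R(1) assms(5)] R(2) by blast
    have "s ^ m = r ^ m"
      using partial_iso_unique[OF radical_isoD(1)[OF R(1)]] radical_iso_ops(4)[OF R(1) s] R(2) by blast
    show ?thesis
    proof (cases "r = 0")
      case True
      then have "s = 0" using partial_isoD(2)[OF radical_isoD(1)[OF R(1)] s] by simp
      moreover have "1 \<in> unity_roots" by (auto simp: unity_roots_def)
      ultimately show ?thesis using s True by (intro bexI[of _ 1]) auto
    next
      case False
      then have "(s / r) ^ m = 1" using \<open>s ^ m = r ^ m\<close> by (simp add: power_divide)
      then have "s / r \<in> unity_roots" using assms(5) by (auto simp: unity_roots_def)
      then show ?thesis using s False by (intro bexI[of _ "s / r"]) auto
    qed
  qed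
  obtain \<zeta> \<xi> where "\<zeta> \<in> unity_roots" "(r, \<zeta> * r) \<in> S" "\<xi> \<in> unity_roots" "(r, \<xi> * r) \<in> T"
    using move[OF S assms(3)] move[OF T assms(4)] by blast
  \<comment> \<open>Relational composition applies \<open>S\<close> first: \<open>r\<close> goes to
    \<open>\<zeta> * r\<close>, then by \<open>T\<close> to the common product, then by
    \<open>S\<inverse>\<close> to \<open>\<xi> * r\<close> and by \<open>T\<inverse>\<close> back to
    \<open>r\<close>.\<close>
  moreover have "(\<zeta> * r, \<zeta> * (\<xi> * r)) \<in> T" "(\<xi> * r, \<xi> * (\<zeta> * r)) \<in> S"
    using calculation radical_iso_ops(3) radical_isoD(2) S T by blast+
  moreover have "\<zeta> * (\<xi> * r) = \<xi> * (\<zeta> * r)" by simp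
  ultimately show ?thesis by (metis converse_iff relcomp.relcompI)
qed

section \<open>Generated subrings and algebraically independent numbers\<close>

inductive_set gen :: "(complex \<times> complex) set \<Rightarrow> (complex \<times> complex) set" for B where
  base: "p \<in> B \<Longrightarrow> p \<in> gen B"
| one: "(1, 1) \<in> gen B"
| add: "(x, y) \<in> gen B \<Longrightarrow> (u, v) \<in> gen B \<Longrightarrow> (x + u, y + v) \<in> gen B"
| diff: "(x, y) \<in> gen B \<Longrightarrow> (u, v) \<in> gen B \<Longrightarrow> (x - u, y - v) \<in> gen B"
| mult: "(x, y) \<in> gen B \<Longrightarrow> (u, v) \<in> gen B \<Longrightarrow> (x * u, y * v) \<in> gen B"

lemma subring_rel_gen: "subring_rel (gen B)"
  by (intro subring_relI) (simp_all add: gen.one gen.add gen.diff gen.mult)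

lemma gen_minimal:
  assumes "subring_rel S" "B \<subseteq> S"
  shows "gen B \<subseteq> S"
proof
  fix p assume "p \<in> gen B"
  then show "p \<in> S" by induction (use assms subring_rel_ops[OF assms(1)] in auto)
qed

text \<open>The generated subring is exhausted by countable stages \<open>L k\<close>, each applying
  the operations once to all pairs of the previous one. The stages increase, so any two elements
  share a stage.\<close>

lemma countable_gen:
  assumes "countable B"
  shows "countable (gen B)"
proof -
  define step where "step A = A \<union> (\<Union>p\<in>A. \<Union>q\<in>A.
      {(fst p + fst q, snd p + snd q), (fst p - fst q, snd p - snd q), (fst p * fst q, snd p * snd q)})"
    for A :: "(complex \<times> complex) set"
  define L where "L k = (step ^^ k) (insert (1, 1) B)" for k
  have "countable (L k)" for k
    unfolding L_def by (induction k) (use assms in \<open>auto simp: step_def\<close>)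
  then have "countable (\<Union>k. L k)" by simp
  moreover have "gen B \<subseteq> (\<Union>k. L k)"
  proof (rule gen_minimal)
    have "L k \<subseteq> L (Suc k)" for k by (auto simp: L_def step_def)
    then have mono: "L k \<subseteq> L l" if "k \<le> l" for k l using that lift_Suc_mono_le[of L] by blast
    have L0: "insert (1, 1) B = L 0" by (simp add: L_def)
    have ops: "(x + u, y + v) \<in> (\<Union>k. L k)" "(x - u, y - v) \<in> (\<Union>k. L k)" "(x * u, y * v) \<in> (\<Union>k. L k)"
      if "(x, y) \<in> (\<Union>k. L k)" "(u, v) \<in> (\<Union>k. L k)" for x y u v
    proof -
      obtain k l where "(x, y) \<in> L k" "(u, v) \<in> L l" using \<open>(x, y) \<in> _\<close> \<open>(u, v) \<in> _\<close> by blast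
      then have in_max: "(x, y) \<in> L (max k l)" "(u, v) \<in> L (max k l)"
        using mono[of k "max k l"] mono[of l "max k l"] by auto
      have "z \<in> step (L (max k l))" if "z \<in> {(x + u, y + v), (x - u, y - v), (x * u, y * v)}" for z
        unfolding step_def
        by (rule UnI2, rule UN_I[OF in_max(1)], rule UN_I[OF in_max(2)]) (use that in simp)
      then have "{(x + u, y + v), (x - u, y - v), (x * u, y * v)} \<subseteq> step (L (max k l))" by blast
      also have "\<dots> = L (Suc (max k l))" by (simp add: L_def)
      finally show "(x + u, y + v) \<in> (\<Union>k. L k)" "(x - u, y - v) \<in> (\<Union>k. L k)"
        "(x * u, y * v) \<in> (\<Union>k. L k)" by blast+
    qed
    show "subring_rel (\<Union>k. L k)"
    proof (rule subring_relI)
      show "(1, 1) \<in> (\<Union>k. L k)" using L0 by blast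
    qed (rule ops; assumption)+
    show "B \<subseteq> (\<Union>k. L k)" using L0 by blast
  qed
  ultimately show ?thesis by (rule countable_subset[rotated])
qed

text \<open>The pairs of values that one polynomial over the ring generated by the roots of unity
  takes at \<open>x\<close> and at \<open>y\<close>.\<close>

definition graph_gen :: "nat \<Rightarrow> (nat \<Rightarrow> complex) \<Rightarrow> (nat \<Rightarrow> complex) \<Rightarrow> (complex \<times> complex) set" where
  "graph_gen n x y = gen (Id_on unity_roots \<union> (\<lambda>i. (x i, y i)) ` {..<n})"

lemma subring_rel_graph_gen: "subring_rel (graph_gen n x y)"
  by (simp add: graph_gen_def subring_rel_gen)

lemma graph_gen_base:
  "Id_on unity_roots \<subseteq> graph_gen n x y" "i < n \<Longrightarrow> (x i, y i) \<in> graph_gen n x y"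
  unfolding graph_gen_def by (auto intro: gen.base)

lemma graph_gen_minimal:
  "subring_rel S \<Longrightarrow> Id_on unity_roots \<subseteq> S \<Longrightarrow> (\<And>i. i < n \<Longrightarrow> (x i, y i) \<in> S) \<Longrightarrow> graph_gen n x y \<subseteq> S"
  unfolding graph_gen_def by (intro gen_minimal) auto

text \<open>First coordinates are built from the \<open>x i\<close> and roots of unity alone. So one
  countable ring contains them for all \<open>y\<close> at once.\<close>

lemma graph_gen_Domain: "(c, d) \<in> graph_gen n x y \<Longrightarrow> c \<in> Domain (graph_gen n x x)"
proof -
  have "graph_gen n x y \<subseteq> {(c, d). c \<in> Domain (graph_gen n x x)}"
  proof (rule graph_gen_minimal)
    show "subring_rel {(c, d). c \<in> Domain (graph_gen n x x)}"
      using subring_rel_graph_gen[of n x x] unfolding subring_rel_def Domain_iff by fastforce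
  qed (use graph_gen_base(1)[of n x x] graph_gen_base(2)[of _ n x x] in blast)+
  then show "(c, d) \<in> graph_gen n x y \<Longrightarrow> c \<in> Domain (graph_gen n x x)" by blast
qed

text \<open>Polynomials over \<open>R\<close> are encoded by finite lists over \<open>R\<close>, and
  each nonzero one has finitely many roots.\<close>

lemma countable_roots_over:
  fixes R :: "complex set"
  assumes "countable R"
  shows "countable {z. \<exists>p. p \<noteq> 0 \<and> (\<forall>i. coeff p i \<in> R) \<and> poly p z = 0}"
proof -
  let ?P = "{p. p \<noteq> 0 \<and> (\<forall>i. coeff p i \<in> R)}"
  have "?P \<subseteq> Poly ` lists R"
  proof
    fix p assume "p \<in> ?P"
    then have "coeffs p \<in> lists R" by (auto simp: coeffs_def)
    then show "p \<in> Poly ` lists R" by (metis Poly_coeffs image_eqI)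
  qed
  then have "countable ?P" using assms by (meson countable_image countable_lists countable_subset)
  then have "countable (\<Union>p\<in>?P. {z. poly p z = 0})"
    by (rule countable_UN) (auto intro: countable_finite poly_roots_finite)
  then show ?thesis by (rule countable_subset[rotated]) auto
qed

text \<open>Algebraic independence of \<open>x 0, \<dots>, x (n - 1)\<close> over the roots of unity, in the form that
  every assignment of values to the \<open>x i\<close> respects all relations between them.\<close>
definition generic :: "nat \<Rightarrow> (nat \<Rightarrow> complex) \<Rightarrow> bool" where
  "generic n x \<longleftrightarrow> (\<forall>y v. (0, v) \<in> graph_gen n x y \<longrightarrow> v = 0)"

text \<open>The next number \<open>z\<close> is chosen transcendental over the countable ring
  generated so far. A relation is then a polynomial \<open>p\<close> in \<open>z\<close> with
  \<open>poly p z = 0\<close>, hence \<open>p = 0\<close>, and by the induction hypothesis its image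
  \<open>q\<close> is zero as well.\<close>

lemma generic_exists: "\<exists>x. generic n x"
proof (induction n)
  case 0
  have "graph_gen 0 x y \<subseteq> Id" for x y :: "nat \<Rightarrow> complex"
    by (intro graph_gen_minimal) (auto simp: subring_rel_def)
  then show ?case unfolding generic_def by blast
next
  case (Suc n)
  then obtain x where x: "generic n x" by blast
  let ?R = "Domain (graph_gen n x x)"
  have "countable (graph_gen n x x)"
    unfolding graph_gen_def by (intro countable_gen) (auto simp: Id_on_def countable_unity_roots)
  then have "countable ?R" by (simp add: Domain_fst)
  then have "{z. \<exists>p. p \<noteq> 0 \<and> (\<forall>i. coeff p i \<in> ?R) \<and> poly p z = 0} \<noteq> UNIV"
    using countable_roots_over[of ?R] uncountable_UNIV_complex by metis
  then obtain z where z: "\<And>p. p \<noteq> 0 \<Longrightarrow> (\<forall>i. coeff p i \<in> ?R) \<Longrightarrow> poly p z \<noteq> 0"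
    by blast
  have "v = 0" if v: "(0, v) \<in> graph_gen (Suc n) (x(n := z)) y" for y v
  proof -
    note S = subring_rel_graph_gen[of n x y]
    have "graph_gen (Suc n) (x(n := z)) y \<subseteq> adjoin (graph_gen n x y) z (y n)"
    proof (rule graph_gen_minimal[OF subring_rel_adjoin[OF S]])
      show "Id_on unity_roots \<subseteq> adjoin (graph_gen n x y) z (y n)"
        using graph_gen_base(1) adjoin_base[OF S] by blast
      show "((x(n := z)) i, y i) \<in> adjoin (graph_gen n x y) z (y n)" if "i < Suc n" for i
        using that adjoin_new[OF S, of z "y n"] adjoin_base[OF S, of z "y n"] graph_gen_base(2)[of i n x y]
        by (cases "i = n") auto
    qed
    then obtain p q where pq: "(p, q) \<in> poly_rel (graph_gen n x y)" "poly p z = 0" "v = poly q (y n)"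
      using v unfolding adjoin_def by fastforce
    have "\<forall>i. coeff p i \<in> ?R" using pq(1) graph_gen_Domain unfolding poly_rel_iff by blast
    then have "p = 0" using z pq(2) by blast
    then have "q = 0" using pq(1) x unfolding generic_def poly_rel_iff by (auto simp: poly_eq_iff)
    then show ?thesis using pq(3) by simp
  qed
  then show ?case unfolding generic_def by blast
qed

lemma generic_inj:
  assumes "generic n x" "i < n" "j < n" "x i = x j"
  shows "i = j"
proof (rule ccontr)
  assume "i \<noteq> j"
  \<comment> \<open>An assignment that violates the relation \<open>x i - x j = 0\<close>.\<close>
  define y :: "nat \<Rightarrow> complex" where "y l = (if l = i then 1 else 0)" for l
  have "(x i - x j, y i - y j) \<in> graph_gen n x y"
    using assms(2,3) by (intro subring_rel_ops[OF subring_rel_graph_gen] graph_gen_base(2))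
  then have "(0, 1) \<in> graph_gen n x y" using assms(4) \<open>i \<noteq> j\<close> by (simp add: y_def)
  then show False using assms(1) unfolding generic_def by fastforce
qed

section \<open>Three-cycles and their lifts\<close>

definition cyc3 :: "nat \<Rightarrow> nat \<Rightarrow> nat \<Rightarrow> nat \<Rightarrow> nat" where
  "cyc3 a b c i = (if i = a then b else if i = b then c else if i = c then a else i)"

lemma cyc3_less: "a < n \<Longrightarrow> b < n \<Longrightarrow> c < n \<Longrightarrow> i < n \<Longrightarrow> cyc3 a b c i < n"
  by (simp add: cyc3_def)

lemma cyc3_cube: "distinct [a, b, c] \<Longrightarrow> cyc3 a b c (cyc3 a b c (cyc3 a b c i)) = i"
  by (auto simp: cyc3_def)

text \<open>With \<open>s = cyc3 a d c\<close> and \<open>t = cyc3 a e b\<close>, which share only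
  the point \<open>a\<close>, this is the commutator identity for \<open>cyc3 a b c\<close>, the
  inverses of \<open>s\<close> and \<open>t\<close> being moved to the other side.\<close>

lemma cyc3_commutator:
  assumes "distinct [a, b, c, d, e]"
  shows "cyc3 a d c (cyc3 a e b (cyc3 a b c i)) = cyc3 a e b (cyc3 a d c i)"
proof -
  have ne: "a \<noteq> b" "a \<noteq> c" "a \<noteq> d" "a \<noteq> e" "b \<noteq> c" "b \<noteq> d" "b \<noteq> e" "c \<noteq> d" "c \<noteq> e" "d \<noteq> e"
    using assms by simp_all
  consider "i = a" | "i = b" | "i = c" | "i = d" | "i = e" | "i \<notin> {a, b, c, d, e}" by blast
  then show ?thesis by cases (simp_all add: cyc3_def ne ne[symmetric])
qed

text \<open>By genericity \<open>?G\<close> relates 0 only to 0. For the converse direction,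
  \<open>?G\<close> is contained in the converse of the graph for the inverse cycle
  \<open>?s \<circ> ?s\<close>, to which genericity applies again.\<close>

lemma generic_permutation_iso:
  assumes x: "generic n x" and "a < n" "b < n" "c < n" "distinct [a, b, c]"
  shows "\<exists>S. radical_iso S \<and> (\<forall>i<n. (x i, x (cyc3 a b c i)) \<in> S)"
proof -
  let ?s = "cyc3 a b c"
  let ?G = "graph_gen n x (x \<circ> ?s)"
  have "?G \<subseteq> (graph_gen n x (x \<circ> ?s \<circ> ?s))\<inverse>"
  proof (rule graph_gen_minimal[OF subring_rel_converse[OF subring_rel_graph_gen]])
    show "Id_on unity_roots \<subseteq> (graph_gen n x (x \<circ> ?s \<circ> ?s))\<inverse>"
      using graph_gen_base(1) by blast
    show "(x i, (x \<circ> ?s) i) \<in> (graph_gen n x (x \<circ> ?s \<circ> ?s))\<inverse>" if "i < n" for i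
      using graph_gen_base(2)[of "?s i" n x "x \<circ> ?s \<circ> ?s"] cyc3_less[OF assms(2-4) that]
        cyc3_cube[OF assms(5)] by simp
  qed
  then have "partial_iso ?G"
    using x subring_rel_graph_gen unfolding partial_iso_def generic_def by blast
  then obtain S where "radical_iso S" "?G \<subseteq> S"
    using radical_iso_extension[OF _ graph_gen_base(1)] by blast
  moreover have "(x i, x (?s i)) \<in> ?G" if "i < n" for i
    using graph_gen_base(2)[OF that, of x "x \<circ> ?s"] by simp
  ultimately show ?thesis by blast
qed

section \<open>The invariant under radical steps\<close>

text \<open>All 3-cycles are treated at once because a radical step obtains the lift of one cycle
  from lifts of two others.\<close>

definition cycles_lift :: "nat \<Rightarrow> (nat \<Rightarrow> complex) \<Rightarrow> complex set \<Rightarrow> bool" where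
  "cycles_lift n x M \<longleftrightarrow> (\<forall>a<n. \<forall>b<n. \<forall>c<n. distinct [a, b, c] \<longrightarrow>
    (\<exists>S. radical_iso S \<and> (\<forall>i<n. (x i, x (cyc3 a b c i)) \<in> S) \<and> Id_on M \<subseteq> S))"

text \<open>The points \<open>a\<close>, \<open>b\<close>, \<open>c\<close> may coincide, so this
  also yields two points distinct from a single given one.\<close>

lemma two_more:
  assumes "n \<ge> 5"
  obtains d e :: nat where "d < n" "e < n" "d \<notin> {a, b, c}" "e \<notin> {a, b, c, d}"
proof -
  have pick: "\<exists>d<n. d \<notin> set ds" if "length ds < 5" for ds
  proof (rule ccontr)
    assume "\<not> ?thesis"
    then have "{..<n} \<subseteq> set ds" by auto
    then have "n \<le> card (set ds)" using card_mono[of "set ds" "{..<n}"] by simp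
    then show False using card_length[of ds] that assms by simp
  qed
  obtain d where d: "d < n" "d \<notin> {a, b, c}" using pick[of "[a, b, c]"] by auto
  obtain e where "e < n" "e \<notin> {a, b, c, d}" using pick[of "[a, b, c, d]"] by auto
  with d show ?thesis using that by blast
qed

lemma cycles_lift_radical:
  assumes "n \<ge> 5" "cycles_lift n x M" "r ^ m \<in> M" "m > 0"
  shows "cycles_lift n x (insert r M)"
  unfolding cycles_lift_def
proof (intro allI impI)
  fix a b c assume abc: "a < n" "b < n" "c < n" "distinct [a, b, c]"
  obtain d e where de: "d < n" "e < n" "d \<notin> {a, b, c}" "e \<notin> {a, b, c, d}"
    using two_more[OF assms(1)] .
  have dist: "distinct [a, d, c]" "distinct [a, e, b]" "distinct [a, b, c, d, e]"
    using abc(4) de(3,4) by auto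
  obtain S where S: "radical_iso S" "\<And>i. i < n \<Longrightarrow> (x i, x (cyc3 a d c i)) \<in> S" "Id_on M \<subseteq> S"
    using assms(2) abc de dist(1) unfolding cycles_lift_def by meson
  obtain T where T: "radical_iso T" "\<And>i. i < n \<Longrightarrow> (x i, x (cyc3 a e b i)) \<in> T" "Id_on M \<subseteq> T"
    using assms(2) abc de dist(2) unfolding cycles_lift_def by meson
  let ?C = "S O T O S\<inverse> O T\<inverse>"
  have "radical_iso ?C" by (intro radical_iso_comp radical_iso_converse S T)
  moreover have "(x i, x (cyc3 a b c i)) \<in> ?C" if "i < n" for i
  proof -
    let ?j = "cyc3 a b c i"
    have j: "?j < n" using cyc3_less abc(1-3) that .
    have "(x i, x (cyc3 a d c i)) \<in> S" using S(2) that .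
    moreover have "(x (cyc3 a d c i), x (cyc3 a e b (cyc3 a d c i))) \<in> T"
      by (intro T(2) cyc3_less abc de that)
    \<comment> \<open>The last two factors of \<open>?C\<close> are converses, so these pairs are
      traversed from right to left. By the commutator identity this one starts where the pair in
      \<open>T\<close> ended.\<close>
    moreover have "(x (cyc3 a e b ?j), x (cyc3 a e b (cyc3 a d c i))) \<in> S"
      using S(2)[OF cyc3_less[OF abc(1) de(2) abc(2) j]] cyc3_commutator[OF dist(3)] by simp
    moreover have "(x ?j, x (cyc3 a e b ?j)) \<in> T" using T(2) j .
    ultimately show ?thesis by blast
  qed
  moreover have "(r, r) \<in> ?C"
    using commutator_fixes_radical[OF S(1) T(1) _ _ assms(4)] S(3) T(3) assms(3) by blast
  then have "Id_on (insert r M) \<subseteq> ?C" using S(3) T(3) by blast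
  ultimately show "\<exists>S. radical_iso S \<and> (\<forall>i<n. (x i, x (cyc3 a b c i)) \<in> S) \<and> Id_on (insert r M) \<subseteq> S"
    by blast
qed

text \<open>The isomorphisms that serve for \<open>M\<close> serve unchanged for
  \<open>insert z M\<close>.\<close>

lemma cycles_lift_insert:
  assumes "cycles_lift n x M" "\<And>S. radical_iso S \<Longrightarrow> Id_on M \<subseteq> S \<Longrightarrow> (z, z) \<in> S"
  shows "cycles_lift n x (insert z M)"
proof -
  have "Id_on (insert z M) \<subseteq> S" if "radical_iso S" "Id_on M \<subseteq> S" for S
    using that assms(2)[OF that] by blast
  then show ?thesis using assms(1) unfolding cycles_lift_def by meson
qed

lemma cycles_lift_step:
  assumes "n \<ge> 5" "radical_step M N" "cycles_lift n x M"
  shows "cycles_lift n x N"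
  using assms(2)
proof cases
  case (root y m r)
  then show ?thesis using cycles_lift_radical[OF assms(1,3), of r m] by simp
next
  case (add y z)
  show ?thesis unfolding add(1)
    by (rule cycles_lift_insert[OF assms(3)], rule radical_iso_ops(1)) (use add in blast)+
next
  case (diff y z)
  show ?thesis unfolding diff(1)
    by (rule cycles_lift_insert[OF assms(3)], rule radical_iso_ops(2)) (use diff in blast)+
next
  case (mult y z)
  show ?thesis unfolding mult(1)
    by (rule cycles_lift_insert[OF assms(3)], rule radical_iso_ops(3)) (use mult in blast)+
next
  case (divide y z)
  show ?thesis unfolding divide(1)
    by (rule cycles_lift_insert[OF assms(3)], rule radical_isoD(3)) (use divide in blast)+
qed

lemma cycles_lift_expressible:
  assumes "n \<ge> 5" "cycles_lift n x X" "expressible_by_radicals X z"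
  obtains M where "cycles_lift n x M" "z \<in> M"
proof -
  obtain M where M: "radical_step\<^sup>*\<^sup>* X M" "z \<in> M"
    using assms(3) unfolding expressible_by_radicals_def by blast
  have "cycles_lift n x M"
    using M(1) by induction (use assms(2) cycles_lift_step[OF assms(1)] in auto)
  then show ?thesis using that M(2) by blast
qed

section \<open>The polynomial with algebraically independent roots\<close>

theorem theorem1:
  fixes n :: nat
  assumes "n \<ge> 5"
  shows "\<exists>a :: nat \<Rightarrow> complex. \<forall>x :: complex.
    x ^ n + (\<Sum>i<n. a i * x ^ i) = 0 \<longrightarrow>
    \<not> expressible_by_radicals (insert 1 (a ` {..<n})) x"
proof -
  obtain x where x: "generic n x" using generic_exists by blast
  let ?f = "\<Prod>i<n. [:- x i, 1:]"
  let ?X = "insert 1 (coeff ?f ` {..<n})"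
  have deg: "degree ?f = n" by (subst degree_prod_eq_sum_degree) auto
  have lead: "lead_coeff ?f = 1" by (simp add: lead_coeff_prod)
  have eval: "z ^ n + (\<Sum>i<n. coeff ?f i * z ^ i) = poly ?f z" for z
    unfolding poly_altdef deg using lead deg by (simp add: lessThan_Suc_atMost[symmetric])
  have lift: "cycles_lift n x ?X"
    unfolding cycles_lift_def
  proof (intro allI impI)
    fix a b c assume abc: "a < n" "b < n" "c < n" "distinct [a, b, c]"
    let ?s = "cyc3 a b c"
    obtain S where S: "radical_iso S" "\<And>i. i < n \<Longrightarrow> (x i, x (?s i)) \<in> S"
      using generic_permutation_iso[OF x abc] by blast
    note sub = partial_isoD(1)[OF radical_isoD(1)[OF S(1)]]
    \<comment> \<open>The inverse of \<open>?s\<close> is its square. Since \<open>S\<close> sends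
      \<open>?f\<close> to the polynomial with permuted roots, which is \<open>?f\<close> again, it
      fixes all coefficients.\<close>
    have "bij_betw ?s {..<n} {..<n}"
      by (rule bij_betw_byWitness[of _ "\<lambda>i. ?s (?s i)"])
        (use cyc3_cube[OF abc(4)] cyc3_less[OF abc(1-3)] in auto)
    then have "(\<Prod>i<n. [:- x (?s i), 1:]) = ?f" by (rule prod.reindex_bij_betw)
    moreover have "(?f, \<Prod>i<n. [:- x (?s i), 1:]) \<in> poly_rel S"
    proof (rule poly_rel_prod[OF sub])
      fix i assume "i \<in> {..<n}"
      then have "(- x i, - x (?s i)) \<in> S"
        using subring_rel_ops(3)[OF sub subring_rel_zero[OF sub] S(2)[of i]] by simp
      then show "([:- x i, 1:], [:- x (?s i), 1:]) \<in> poly_rel S"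
        using subring_rel_zero[OF sub] subring_rel_ops(1)[OF sub]
        by (auto simp: poly_rel_iff coeff_pCons split: nat.split)
    qed simp
    ultimately have "(coeff ?f i, coeff ?f i) \<in> S" for i by (simp add: poly_rel_iff)
    then have "Id_on ?X \<subseteq> S" using subring_rel_ops(1)[OF sub] by auto
    then show "\<exists>S. radical_iso S \<and> (\<forall>i<n. (x i, x (?s i)) \<in> S) \<and> Id_on ?X \<subseteq> S"
      using S by blast
  qed
  have "\<not> expressible_by_radicals ?X z" if z: "poly ?f z = 0" for z
  proof
    assume "expressible_by_radicals ?X z"
    then obtain M where M: "cycles_lift n x M" "z \<in> M"
      using cycles_lift_expressible[OF assms lift] by blast
    obtain i where i: "i < n" "z = x i" using z by (auto simp: poly_prod)
    \<comment> \<open>Any two further indices give a 3-cycle that moves \<open>i\<close> to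
      \<open>j\<close>; its lift would have to send \<open>x i\<close> both to \<open>x j\<close>
      and to itself.\<close>
    obtain j k where jk: "j < n" "k < n" "j \<notin> {i, i, i}" "k \<notin> {i, i, i, j}"
      using two_more[OF assms] .
    have "\<exists>S. radical_iso S \<and> (\<forall>l<n. (x l, x (cyc3 i j k l)) \<in> S) \<and> Id_on M \<subseteq> S"
      using M(1) i(1) jk unfolding cycles_lift_def by simp
    then obtain S where S: "radical_iso S" "\<And>l. l < n \<Longrightarrow> (x l, x (cyc3 i j k l)) \<in> S" "Id_on M \<subseteq> S"
      by blast
    have "(x i, x j) \<in> S" using S(2)[OF i(1)] by (simp add: cyc3_def)
    moreover have "(x i, x i) \<in> S" using S(3) M(2) i(2) by blast
    ultimately have "x i = x j" using partial_iso_unique[OF radical_isoD(1)[OF S(1)]] by blast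
    then show False using generic_inj[OF x i(1) jk(1)] jk(3) by simp
  qed
  then show ?thesis using eval by (intro exI[of _ "coeff ?f"]) simp
qed

end
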